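(* A cirquent is provable in $\mathbf{CCC}$ iff it is a tautology.
   Context: Formulas are built from infinitely many propositional atoms using $\neg$ (applied only to atoms; $\neg\neg F$ abbreviates $F$, and $\neg$ of a compound formula is understood via De Morgan's laws), $\wedge$ and $\vee$. A $k$-ary cirquent is a pair consisting of a pool, i.e. a sequence $\langle F_1,\ldots,F_k\rangle$ of formulas (their occurrences are called oformulas), and a structure, i.e. a finite sequence of groups, each group being a subset of $\{1,\ldots,k\}$, thought of as the set of oformulas it contains (occurrences of groups are called ogroups). A formula $F$ is identified with the cirquent with pool $\langle F\rangle$ and structure $\langle\{1\}\rangle$. A classical model assigns a truth value to each atom and extends to formulas in the standard way. A group of a cirquent is true in a model iff at least one of its oformulas is true; a cirquent is true in a model iff all of its groups are true; a cirquent is a tautology iff it is true in every model. $\mathbf{CCC}$ is the cirquent calculus system with the following eight rules, and a proof of a cirquent is a tree of cirquents with that cirquent at the root, each node following from its children by a rule (leaves being axioms). (Axioms) the empty cirquent (empty pool and empty structure), and the identity axiom: pool $\langle\neg F,F\rangle$, structure $\langle\{1,2\}\rangle$. (Mix) from two premises, the conclusion places one next to the other (concatenating pools and structures). (Exchange) swap two adjacent oformulas, correspondingly redirecting group membership, or swap two adjacent ogroups. (Weakening) add an existing oformula to an existing ogroup, or insert a new oformula anywhere in the pool (belonging to no group). (Duplication) downward: replace an ogroup by two adjacent ogroups identical to it as groups; upward: the converse. (Contraction) merge two adjacent oformulas that are the same formula $F$ into one oformula $F$, every ogroup that contained either of them now containing the merged one. ($\vee$-introduction) merge two adjacent oformulas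 $F,G$ into one oformula $F\vee G$, so that an ogroup of the conclusion contains $F\vee G$ iff the corresponding ogroup of the premise contains at least one of $F,G$. ($\wedge$-introduction) the premise has adjacent oformulas $F,G$ such that no ogroup contains both, every ogroup containing $F$ is immediately followed by an ogroup containing $G$, and every ogroup containing $G$ is immediately preceded by an ogroup containing $F$; the conclusion merges each ogroup containing $F$ with the immediately following ogroup (taking the union), and then merges $F$ and $G$ into the single oformula $F\wedge G$. *)

theory Defs
  imports Main "HOL-Combinatorics.Transposition"
begin

datatype 'a formula =
    Atom 'a
  | NegAtom 'a
  | Conj "'a formula" "'a formula"
  | Disj "'a formula" "'a formula"

text \<open>Negation is an abbreviation: only atoms are negated in the syntax.\<close>

primrec neg :: "'a formula \<Rightarrow> 'a formula" where
  "neg (Atom p) = NegAtom p"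
| "neg (NegAtom p) = Atom p"
| "neg (Conj F G) = Disj (neg F) (neg G)"
| "neg (Disj F G) = Conj (neg F) (neg G)"

text \<open>A cirquent is a pool together with a structure. Oformulas are identified with their
  positions in the pool, counted from 0 as usual for lists, so that a group of a
  \<open>k\<close>-ary cirquent is a subset of \<open>{0, ..., k - 1}\<close>; groups may be empty.
  The bare type does not enforce this bound, \<open>is_cirquent\<close> does.\<close>

type_synonym group = "nat set"
type_synonym 'a cirquent = "'a formula list \<times> group list"

definition is_cirquent :: "'a cirquent \<Rightarrow> bool" where
  "is_cirquent C \<longleftrightarrow> (\<forall>A \<in> set (snd C). A \<subseteq> {..<length (fst C)})"

type_synonym 'a model = "'a \<Rightarrow> bool"

primrec formula_true :: "'a model \<Rightarrow> 'a formula \<Rightarrow> bool" where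
  "formula_true M (Atom p) \<longleftrightarrow> M p"
| "formula_true M (NegAtom p) \<longleftrightarrow> \<not> M p"
| "formula_true M (Conj F G) \<longleftrightarrow> formula_true M F \<and> formula_true M G"
| "formula_true M (Disj F G) \<longleftrightarrow> formula_true M F \<or> formula_true M G"

definition group_true :: "'a model \<Rightarrow> 'a formula list \<Rightarrow> group \<Rightarrow> bool" where
  "group_true M P A \<longleftrightarrow> (\<exists>j \<in> A. formula_true M (P ! j))"

definition cirquent_true :: "'a model \<Rightarrow> 'a cirquent \<Rightarrow> bool" where
  "cirquent_true M C \<longleftrightarrow> (\<forall>A \<in> set (snd C). group_true M (fst C) A)"

definition tautology :: "'a cirquent \<Rightarrow> bool" where
  "tautology C \<longleftrightarrow> (\<forall>M. cirquent_true M C)"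

text \<open>Renumberings of oformulas: \<open>skip_pos i\<close> makes room for a new oformula at
  position \<open>i\<close>; \<open>merge_pos i\<close> sends both \<open>i\<close> and \<open>i + 1\<close> to \<open>i\<close> and closes the gap.\<close>

definition skip_pos :: "nat \<Rightarrow> nat \<Rightarrow> nat" where
  "skip_pos i j = (if j < i then j else Suc j)"

definition merge_pos :: "nat \<Rightarrow> nat \<Rightarrow> nat" where
  "merge_pos i j = (if j \<le> i then j else j - 1)"

definition renumber :: "(nat \<Rightarrow> nat) \<Rightarrow> group list \<Rightarrow> group list" where
  "renumber f S = map (\<lambda>A. f ` A) S"

text \<open>The side condition and the merging of ogroups in conjunction introduction, for the
  adjacent oformulas at positions \<open>i\<close> and \<open>i + 1\<close>.\<close>

definition conj_ready :: "nat \<Rightarrow> group list \<Rightarrow> bool" where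
  "conj_ready i S \<longleftrightarrow> (\<forall>m < length S.
      \<not> (i \<in> S ! m \<and> Suc i \<in> S ! m) \<and>
      (i \<in> S ! m \<longrightarrow> Suc m < length S \<and> Suc i \<in> S ! Suc m) \<and>
      (Suc i \<in> S ! m \<longrightarrow> 0 < m \<and> i \<in> S ! (m - 1)))"

fun merge_groups :: "nat \<Rightarrow> group list \<Rightarrow> group list" where
  "merge_groups i (A # B # S) =
     (if i \<in> A then (A \<union> B) # merge_groups i S else A # merge_groups i (B # S))"
| "merge_groups i [A] = [A]"
| "merge_groups i [] = []"

inductive CCC_provable :: "'a cirquent \<Rightarrow> bool" where
  empty_axiom:
    "CCC_provable ([], [])"
| identity_axiom:
    "CCC_provable ([neg F, F], [{0, 1}])"
| mix:
    "CCC_provable (P, S) \<Longrightarrow> CCC_provable (Q, T) \<Longrightarrow>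
     CCC_provable (P @ Q, S @ renumber (\<lambda>j. length P + j) T)"
| exchange_oformulas:
    "CCC_provable (P @ [F, G] @ Q, S) \<Longrightarrow>
     CCC_provable (P @ [G, F] @ Q, renumber (transpose (length P) (Suc (length P))) S)"
| exchange_ogroups:
    "CCC_provable (P, S @ [A, B] @ T) \<Longrightarrow> CCC_provable (P, S @ [B, A] @ T)"
| weakening_ogroup:
    "CCC_provable (P, S @ [A] @ T) \<Longrightarrow> j < length P \<Longrightarrow>
     CCC_provable (P, S @ [insert j A] @ T)"
| weakening_pool:
    "CCC_provable (P @ Q, S) \<Longrightarrow>
     CCC_provable (P @ [F] @ Q, renumber (skip_pos (length P)) S)"
| duplication_downward:
    "CCC_provable (P, S @ [A] @ T) \<Longrightarrow> CCC_provable (P, S @ [A, A] @ T)"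
| duplication_upward:
    "CCC_provable (P, S @ [A, A] @ T) \<Longrightarrow> CCC_provable (P, S @ [A] @ T)"
| contraction:
    "CCC_provable (P @ [F, F] @ Q, S) \<Longrightarrow>
     CCC_provable (P @ [F] @ Q, renumber (merge_pos (length P)) S)"
| disj_introduction:
    "CCC_provable (P @ [F, G] @ Q, S) \<Longrightarrow>
     CCC_provable (P @ [Disj F G] @ Q, renumber (merge_pos (length P)) S)"
| conj_introduction:
    "CCC_provable (P @ [F, G] @ Q, S) \<Longrightarrow> conj_ready (length P) S \<Longrightarrow>
     CCC_provable (P @ [Conj F G] @ Q,
       renumber (merge_pos (length P)) (merge_groups (length P) S))"

lemma neg_neg [simp]: "neg (neg F) = F"
  by (induction F) auto

lemma merge_groups_subset:
  "\<forall>A \<in> set S. A \<subseteq> U \<Longrightarrow> A \<in> set (merge_groups i S) \<Longrightarrow> A \<subseteq> U"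
  by (induction i S rule: merge_groups.induct) (auto split: if_splits)

text \<open>Every node of a proof is a genuine cirquent.\<close>

lemma CCC_provable_is_cirquent: "CCC_provable C \<Longrightarrow> is_cirquent C"
proof (induction rule: CCC_provable.induct)
  case (exchange_oformulas P F G Q S)
  then show ?case
    by (fastforce simp: is_cirquent_def renumber_def transpose_def)
next
  case (conj_introduction P F G Q S)
  let ?U = "{..<length (P @ [F, G] @ Q)}"
  have "A \<subseteq> ?U" if "A \<in> set (merge_groups (length P) S)" for A
    using merge_groups_subset[of S ?U A] conj_introduction.IH that
    by (auto simp: is_cirquent_def)
  then show ?case
    by (fastforce simp: is_cirquent_def renumber_def merge_pos_def)
qed (fastforce simp: is_cirquent_def renumber_def skip_pos_def merge_pos_def)+

end

theory Submission
  imports Defs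
begin

text \<open>Soundness holds rule by rule. For completeness, weakening, exchange and contraction
  together allow any label-preserving renumbering of the pool, even a non-injective one. Hence two
  provable cirquents with the same pool may be put together by mixing them and then contracting the
  doubled pool, and it suffices to prove every valid disjunction of a list of oformulas as a
  one-group cirquent. This is done by inverting the connectives down to literals.\<close>

section \<open>Soundness\<close>

lemma formula_true_neg: "formula_true M (neg F) \<longleftrightarrow> \<not> formula_true M F"
  by (induction F) auto

text \<open>A true oformula at \<open>j\<close> carries its ogroup's truth to \<open>f j\<close>.
  Only the forward implication is asked for, so that an oformula may also be replaced by a weaker
  one, as in disjunction introduction.\<close>

lemma renumber_cirquent_true:
  assumes "is_cirquent (P, S)" "cirquent_true M (P, S)"
    and "\<And>j. j < length P \<Longrightarrow> formula_true M (P ! j) \<Longrightarrow> formula_true M (Q ! f j)"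
  shows "cirquent_true M (Q, renumber f S)"
  using assms unfolding is_cirquent_def cirquent_true_def group_true_def renumber_def
  by (fastforce simp: subset_iff)

section \<open>Merging of ogroups in conjunction introduction\<close>

lemma conj_readyD:
  assumes "conj_ready i S" "m < length S"
  shows "\<not> (i \<in> S ! m \<and> Suc i \<in> S ! m)"
    and "i \<in> S ! m \<Longrightarrow> Suc m < length S \<and> Suc i \<in> S ! Suc m"
    and "Suc i \<in> S ! m \<Longrightarrow> 0 < m \<and> i \<in> S ! (m - 1)"
  using assms by (auto simp: conj_ready_def)

text \<open>The critical position is the head of \<open>S\<close>: it cannot contain
  \<open>Suc i\<close>, since its predecessor \<open>A\<close> would then contain
  \<open>i\<close>.\<close>

lemma conj_ready_ConsD:
  assumes "conj_ready i (A # S)" "i \<notin> A"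
  shows "conj_ready i S"
  unfolding conj_ready_def
proof (intro allI impI)
  fix m assume "m < length S"
  then have "Suc m < length (A # S)" by simp
  with assms(2) conj_readyD[OF assms(1) this] show "\<not> (i \<in> S ! m \<and> Suc i \<in> S ! m) \<and>
      (i \<in> S ! m \<longrightarrow> Suc m < length S \<and> Suc i \<in> S ! Suc m) \<and>
      (Suc i \<in> S ! m \<longrightarrow> 0 < m \<and> i \<in> S ! (m - 1))"
    by (cases m) auto
qed

text \<open>Since \<open>B\<close> contains \<open>Suc i\<close> it omits \<open>i\<close>, so the
  head of \<open>S\<close> again cannot contain \<open>Suc i\<close>. Dropping both partners matches
  the recursion of \<open>merge_groups\<close>.\<close>

lemma conj_ready_Cons_ConsD:
  assumes "conj_ready i (A # B # S)" "i \<in> A"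
  shows "Suc i \<notin> A" "i \<notin> B" "Suc i \<in> B" "conj_ready i S"
proof -
  show *: "Suc i \<notin> A" "i \<notin> B" "Suc i \<in> B"
    using assms conj_readyD[OF assms(1), of 0] conj_readyD[OF assms(1), of 1] by auto
  show "conj_ready i S"
    unfolding conj_ready_def
  proof (intro allI impI)
    fix m assume "m < length S"
    then have "Suc (Suc m) < length (A # B # S)" by simp
    with *(2) conj_readyD[OF assms(1) this] show "\<not> (i \<in> S ! m \<and> Suc i \<in> S ! m) \<and>
        (i \<in> S ! m \<longrightarrow> Suc m < length S \<and> Suc i \<in> S ! Suc m) \<and>
        (Suc i \<in> S ! m \<longrightarrow> 0 < m \<and> i \<in> S ! (m - 1))"
      by (cases m) auto
  qed
qed

text \<open>Each merge consumes both partners, and the remaining ogroups still satisfy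
  \<open>conj_ready\<close>, so no ogroup takes part in two merges and none with \<open>i\<close> or
  \<open>Suc i\<close> is left alone.\<close>

lemma merge_groups_cases:
  assumes "conj_ready i S" "X \<in> set (merge_groups i S)"
  obtains (unmerged) "X \<in> set S" "i \<notin> X" "Suc i \<notin> X"
  | (merged) A B where "X = A \<union> B" "A \<in> set S" "B \<in> set S"
      "i \<in> A" "Suc i \<notin> A" "i \<notin> B" "Suc i \<in> B"
  using assms
proof (induction i S arbitrary: thesis rule: merge_groups.induct)
  case (1 i A B S)
  show ?case
  proof (cases "i \<in> A")
    case True
    note ready = conj_ready_Cons_ConsD[OF "1.prems"(3) True]
    show ?thesis
    proof (cases "X = A \<union> B")
      case X: True
      show ?thesis by (rule "1.prems"(2)[OF X]) (use True ready in auto)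
    next
      case False
      then have "X \<in> set (merge_groups i S)" using "1.prems"(4) True by simp
      then show ?thesis
        using "1.IH"(1)[OF True _ _ ready(4)] "1.prems"(1,2) by (metis list.set_intros(2))
    qed
  next
    case False
    note ready = conj_ready_ConsD[OF "1.prems"(3) False]
    show ?thesis
    proof (cases "X = A")
      case True
      \<comment> \<open>\<open>A\<close> is the first ogroup, so it lacks the predecessor that
        containing \<open>Suc i\<close> would demand.\<close>
      have "Suc i \<notin> A" using conj_readyD(3)[OF "1.prems"(3), of 0] by auto
      then show ?thesis using "1.prems"(1) True False by simp
    next
      case X: False
      then have "X \<in> set (merge_groups i (B # S))" using "1.prems"(4) False by simp
      then show ?thesis
        using "1.IH"(2)[OF False _ _ ready] "1.prems"(1,2) by (metis list.set_intros(2))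
    qed
  qed
next
  case (2 i A)
  then have "i \<notin> A" "Suc i \<notin> A"
    using conj_readyD[OF "2.prems"(3), of 0] by auto
  then show ?case using 2 by simp
next
  case (3 i)
  then show ?case by simp
qed

lemma nth_merge_pos:
  assumes "j < length (P @ [F, G] @ Q)" "j \<noteq> length P" "j \<noteq> Suc (length P)"
  shows "(P @ [H] @ Q) ! merge_pos (length P) j = (P @ [F, G] @ Q) ! j"
proof (cases "j < length P")
  case False
  then have "Suc (Suc (length P)) \<le> j" using assms by simp
  then obtain k where "j = Suc (Suc (length P)) + k" using le_Suc_ex by blast
  then show ?thesis by (simp add: merge_pos_def nth_append)
qed (simp add: merge_pos_def nth_append)

lemma merge_pos_self [simp]: "merge_pos i i = i" "merge_pos i (Suc i) = i"
  by (auto simp: merge_pos_def)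

text \<open>Covers contraction, with \<open>F\<close>, \<open>G\<close>, \<open>H\<close> equal, as
  well as disjunction introduction, with \<open>Disj F G\<close> for \<open>H\<close>.\<close>

lemma merge_cirquent_true:
  assumes "is_cirquent (P @ [F, G] @ Q, S)" "cirquent_true M (P @ [F, G] @ Q, S)"
    and "formula_true M F \<Longrightarrow> formula_true M H" "formula_true M G \<Longrightarrow> formula_true M H"
  shows "cirquent_true M (P @ [H] @ Q, renumber (merge_pos (length P)) S)"
proof (rule renumber_cirquent_true[OF assms(1,2)])
  fix j assume j: "j < length (P @ [F, G] @ Q)" "formula_true M ((P @ [F, G] @ Q) ! j)"
  consider "j = length P" | "j = Suc (length P)" | "j \<noteq> length P" "j \<noteq> Suc (length P)"
    by blast
  then show "formula_true M ((P @ [H] @ Q) ! merge_pos (length P) j)"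
    by cases (use j assms(3,4) nth_merge_pos[OF j(1)] in \<open>auto simp: nth_append\<close>)
qed

text \<open>A merged ogroup \<open>A \<union> B\<close> inherits a true oformula from each of
  \<open>A\<close> and \<open>B\<close>. Either these are exactly \<open>F\<close> and
  \<open>G\<close>, making the conjunction true, or one of them lies outside the merged pair and
  survives unchanged, because \<open>A\<close> omits \<open>Suc i\<close> and \<open>B\<close> omits
  \<open>i\<close>.\<close>

lemma conj_introduction_true:
  assumes wf: "is_cirquent (P @ [F, G] @ Q, S)" and true: "cirquent_true M (P @ [F, G] @ Q, S)"
    and ready: "conj_ready (length P) S"
  shows "cirquent_true M (P @ [Conj F G] @ Q,
    renumber (merge_pos (length P)) (merge_groups (length P) S))"
proof -
  let ?i = "length P" and ?P = "P @ [F, G] @ Q" and ?C = "P @ [Conj F G] @ Q"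
  have group: "\<exists>j\<in>A. j < length ?P \<and> formula_true M (?P ! j)" if "A \<in> set S" for A
    using that wf true unfolding is_cirquent_def cirquent_true_def group_true_def
    by (fastforce simp: subset_iff)
  have other: "\<exists>k\<in>X. formula_true M (?C ! merge_pos ?i k)"
    if "j \<in> X" "j < length ?P" "formula_true M (?P ! j)" "j \<noteq> ?i" "j \<noteq> Suc ?i" for X j
    using that nth_merge_pos[of j P F G Q "Conj F G"] by (intro bexI[of _ j]) simp_all
  have "\<exists>k\<in>X. formula_true M (?C ! merge_pos ?i k)" if "X \<in> set (merge_groups ?i S)" for X
    using ready that
  proof (cases rule: merge_groups_cases)
    case unmerged
    then show ?thesis using group[OF unmerged(1)] other by metis
  next
    case (merged A B)
    obtain a where a: "a \<in> A" "a < length ?P" "formula_true M (?P ! a)"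
      using group merged(2) by blast
    obtain b where b: "b \<in> B" "b < length ?P" "formula_true M (?P ! b)"
      using group merged(3) by blast
    show ?thesis
    proof (cases "a = ?i \<and> b = Suc ?i")
      case True
      then have "formula_true M (?C ! merge_pos ?i ?i)"
        using a b by (simp add: nth_append)
      then show ?thesis using merged by blast
    next
      case False
      then show ?thesis using a b merged other[of a X] other[of b X] by blast
    qed
  qed
  then show ?thesis
    by (auto simp: cirquent_true_def group_true_def renumber_def)
qed

lemma CCC_sound: "CCC_provable C \<Longrightarrow> cirquent_true M C"
proof (induction rule: CCC_provable.induct)
  case empty_axiom
  then show ?case by (simp add: cirquent_true_def)
next
  case (identity_axiom F)
  then show ?case by (auto simp: cirquent_true_def group_true_def formula_true_neg)
next
  case (mix P S Q T)
  \<comment> \<open>The identity renumbering lets the general lemma handle the extension of the pool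
    on the right.\<close>
  have "cirquent_true M (P @ Q, renumber (\<lambda>j. j) S)"
    using mix CCC_provable_is_cirquent by (intro renumber_cirquent_true) (auto simp: nth_append)
  moreover have "cirquent_true M (P @ Q, renumber (\<lambda>j. length P + j) T)"
    using mix CCC_provable_is_cirquent by (intro renumber_cirquent_true) auto
  ultimately show ?case by (auto simp: cirquent_true_def renumber_def)
next
  case (exchange_oformulas P F G Q S)
  have "(P @ [G, F] @ Q) ! transpose (length P) (Suc (length P)) j = (P @ [F, G] @ Q) ! j" for j
    by (auto simp: transpose_def nth_append nth_Cons split: nat.splits)
  then show ?case
    using exchange_oformulas CCC_provable_is_cirquent by (intro renumber_cirquent_true) auto
next
  case (weakening_pool P Q S F)
  have "(P @ [F] @ Q) ! skip_pos (length P) j = (P @ Q) ! j" for j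
    by (auto simp: skip_pos_def nth_append Suc_diff_le)
  then show ?case
    using weakening_pool CCC_provable_is_cirquent by (intro renumber_cirquent_true) auto
next
  case (contraction P F Q S)
  then show ?case using CCC_provable_is_cirquent by (intro merge_cirquent_true) auto
next
  case (disj_introduction P F G Q S)
  then show ?case using CCC_provable_is_cirquent by (intro merge_cirquent_true) auto
next
  case (conj_introduction P F G Q S)
  then show ?case using CCC_provable_is_cirquent by (intro conj_introduction_true) auto
qed (auto simp: cirquent_true_def group_true_def)

section \<open>Renumbering the pool\<close>

lemma renumber_renumber: "renumber f (renumber g S) = renumber (\<lambda>j. f (g j)) S"
  by (simp add: renumber_def image_image)

lemma weaken_front:
  "CCC_provable (P, S) \<Longrightarrow> CCC_provable (Q @ P, renumber (\<lambda>j. length Q + j) S)"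
proof (induction Q)
  case Nil
  then show ?case by (simp add: renumber_def)
next
  case (Cons F Q)
  then have "CCC_provable ([] @ [F] @ (Q @ P),
      renumber (skip_pos (length ([] :: 'a formula list))) (renumber (\<lambda>j. length Q + j) S))"
    by (intro weakening_pool) simp
  then show ?case by (simp add: renumber_renumber skip_pos_def)
qed

text \<open>The right copy of \<open>F\<close> is exchanged leftwards past \<open>L\<close> until
  the two copies are adjacent. Each exchange moves the last entry of \<open>L\<close> into
  \<open>Q\<close>, hence the reverse induction with \<open>Q\<close> arbitrary.\<close>

lemma contraction_at_distance:
  "CCC_provable (P @ [F] @ L @ [F] @ Q, S) \<Longrightarrow>
   CCC_provable (P @ [F] @ L @ Q, renumber (\<lambda>j.
     if j \<le> length P + length L then j
     else if j = Suc (length P + length L) then length P else j - 1) S)"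
proof (induction L arbitrary: Q S rule: rev_induct)
  case Nil
  then have "CCC_provable (P @ [F] @ Q, renumber (merge_pos (length P)) S)"
    by (intro contraction) simp
  moreover have "merge_pos (length P) = (\<lambda>j.
      if j \<le> length P then j else if j = Suc (length P) then length P else j - 1)"
    by (auto simp: merge_pos_def fun_eq_iff)
  ultimately show ?case by (simp cong: if_cong)
next
  case (snoc G L)
  let ?T = "P @ [F] @ L"
  have "CCC_provable (?T @ [F, G] @ Q, renumber (transpose (length ?T) (Suc (length ?T))) S)"
    using snoc.prems by (intro exchange_oformulas) simp
  then have "CCC_provable (P @ [F] @ L @ G # Q, renumber (\<lambda>j.
     if j \<le> length P + length L then j
     else if j = Suc (length P + length L) then length P else j - 1)
     (renumber (transpose (length ?T) (Suc (length ?T))) S))"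
    by (intro snoc.IH) simp
  \<comment> \<open>\<open>G\<close> returns to its old position: the exchange moves it right by
    one, and removing the second \<open>F\<close> moves it back.\<close>
  moreover have "(\<lambda>j. (\<lambda>j.
     if j \<le> length P + length L then j
     else if j = Suc (length P + length L) then length P else j - 1)
     (transpose (length ?T) (Suc (length ?T)) j)) = (\<lambda>j.
     if j \<le> length P + length (L @ [G]) then j
     else if j = Suc (length P + length (L @ [G])) then length P else j - 1)"
    by (auto simp: transpose_def fun_eq_iff)
  ultimately show ?case by (simp only: renumber_renumber append_assoc append.simps)
qed

text \<open>The first entry of \<open>R\<close> is contracted into its twin at position
  \<open>f 0\<close> of \<open>Q\<close>; the rest of \<open>R\<close> follows by induction with
  \<open>f\<close> shifted by one.\<close>

lemma absorb_suffix:
  assumes "CCC_provable (Q @ R, S)"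
    and "\<And>j. j < length R \<Longrightarrow> f j < length Q \<and> Q ! f j = R ! j"
  shows "CCC_provable (Q, renumber (\<lambda>j. if j < length Q then j else f (j - length Q)) S)"
  using assms
proof (induction R arbitrary: S f)
  case Nil
  then have "\<forall>A\<in>set S. A \<subseteq> {..<length Q}"
    using CCC_provable_is_cirquent by (fastforce simp: is_cirquent_def)
  then have "renumber (\<lambda>j. if j < length Q then j else f (j - length Q)) S = S"
    unfolding renumber_def by (intro map_idI) (force simp: image_def)
  then show ?case using Nil by simp
next
  case (Cons F R)
  have f0: "f 0 < length Q" "Q ! f 0 = F" using Cons.prems(2)[of 0] by auto
  then obtain A B where Q: "Q = A @ [F] @ B" and A: "length A = f 0"
    by (metis append_Cons append_Nil id_take_nth_drop length_take less_imp_le min.absorb2)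
  have "CCC_provable (A @ [F] @ B @ [F] @ R, S)"
    using Cons.prems(1) by (simp add: Q)
  from contraction_at_distance[OF this]
  \<comment> \<open>Here \<open>length Q - 1\<close> is \<open>length A + length B\<close>, as
    \<open>Q\<close> is nonempty.\<close>
  have "CCC_provable (Q @ R, renumber (\<lambda>j.
      if j \<le> length Q - 1 then j else if j = Suc (length Q - 1) then f 0 else j - 1) S)"
    by (simp add: Q A cong: if_cong)
  then have "CCC_provable (Q, renumber
      (\<lambda>j. if j < length Q then j else (\<lambda>j. f (Suc j)) (j - length Q)) (renumber (\<lambda>j.
        if j \<le> length Q - 1 then j else if j = Suc (length Q - 1) then f 0 else j - 1) S))"
    using Cons.prems(2) by (intro Cons.IH) fastforce+
  moreover have "(\<lambda>j. (\<lambda>j. if j < length Q then j else (\<lambda>j. f (Suc j)) (j - length Q))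
      ((\<lambda>j. if j \<le> length Q - 1 then j else if j = Suc (length Q - 1) then f 0 else j - 1) j))
    = (\<lambda>j. if j < length Q then j else f (j - length Q))"
    using f0(1) by (auto simp: fun_eq_iff Suc_diff_Suc)
  ultimately show ?case by (simp only: renumber_renumber)
qed

text \<open>Weakening places all of \<open>Q\<close> in front of \<open>P\<close>, and then every
  oformula of \<open>P\<close> is absorbed by its image in \<open>Q\<close>. The map may identify
  oformulas and miss others.\<close>

lemma CCC_renumber:
  assumes "CCC_provable (P, S)"
    and "\<And>j. j < length P \<Longrightarrow> f j < length Q \<and> Q ! f j = P ! j"
  shows "CCC_provable (Q, renumber f S)"
  using absorb_suffix[OF weaken_front[OF assms(1), of Q], of f] assms(2)
  by (simp add: renumber_renumber)

text \<open>Mix yields the doubled pool \<open>P @ P\<close>; the second copy is folded onto the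
  first.\<close>

lemma CCC_append_structures:
  assumes "CCC_provable (P, S)" "CCC_provable (P, T)"
  shows "CCC_provable (P, S @ T)"
proof -
  let ?f = "\<lambda>j. if j < length P then j else j - length P"
  have "CCC_provable (P, renumber ?f (S @ renumber (\<lambda>j. length P + j) T))"
    by (rule CCC_renumber[OF mix[OF assms]]) (auto simp: nth_append)
  moreover have "renumber ?f S = S"
    using CCC_provable_is_cirquent[OF assms(1)]
    unfolding renumber_def is_cirquent_def by (intro map_idI) (force simp: image_def)
  moreover have "renumber ?f (renumber (\<lambda>j. length P + j) T) = T"
    by (simp add: renumber_renumber) (simp add: renumber_def)
  ultimately show ?thesis by (simp add: renumber_def)
qed

section \<open>Completeness\<close>

lemma weakening_group:
  assumes "CCC_provable (P, [A])" "B \<subseteq> {..<length P}" "A \<subseteq> B"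
  shows "CCC_provable (P, [B])"
proof -
  have "CCC_provable (P, [D \<union> A])" if "finite D" "D \<subseteq> {..<length P}" for D
    using that
  proof (induction D rule: finite_induct)
    case (insert j D)
    then show ?case using weakening_ogroup[of P "[]" "D \<union> A" "[]" j] by simp
  qed (use assms in simp)
  from this[of B] show ?thesis
    using assms(2,3) finite_subset by (metis finite_lessThan sup_absorb1)
qed

text \<open>Ensures that the group of all oformulas remains full when two neighbours are
  merged.\<close>

lemma merge_pos_lessThan: "i < n \<Longrightarrow> merge_pos i ` {..<Suc n} = {..<n}"
proof (intro equalityI subsetI)
  fix k assume "i < n" "k \<in> {..<n}"
  then show "k \<in> merge_pos i ` {..<Suc n}"
    by (intro image_eqI[of _ _ "if k \<le> i then k else Suc k"]) (auto simp: merge_pos_def)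
qed (auto simp: merge_pos_def)

section \<open>Valid disjunctions, from literals upwards\<close>

lemma literal_disjunction_provable:
  assumes taut: "\<And>M. \<exists>F\<in>set P. formula_true M F"
    and lit: "\<And>F. F \<in> set P \<Longrightarrow> (\<exists>p. F = Atom p \<or> F = NegAtom p)"
  shows "CCC_provable (P, [{..<length P}])"
proof -
  \<comment> \<open>This model falsifies every negative literal of \<open>P\<close>, so the true
    literal is some \<open>Atom p\<close>, and by the choice of the model \<open>NegAtom p\<close>
    occurs in \<open>P\<close> too.\<close>
  obtain F where F: "F \<in> set P" "formula_true (\<lambda>p. NegAtom p \<in> set P) F"
    using taut by blast
  then obtain p where "Atom p \<in> set P" "NegAtom p \<in> set P" using lit by fastforce
  then obtain a b where ab: "a < length P" "P ! a = Atom p" "b < length P" "P ! b = NegAtom p"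
    by (metis in_set_conv_nth)
  \<comment> \<open>The identity axiom lists the negation first, so 0 goes to \<open>b\<close> and 1
    to \<open>a\<close>.\<close>
  have "CCC_provable (P, renumber (\<lambda>j. if j = 0 then b else a) [{0, 1}])"
    using ab by (intro CCC_renumber[OF identity_axiom[of "Atom p"]]) (auto simp: less_Suc_eq)
  then show ?thesis
    unfolding renumber_def list.map by (rule weakening_group) (use ab in auto)
qed

lemma disj_disjunction_provable:
  assumes "CCC_provable (P @ [F, G] @ Q, [{..<length (P @ [F, G] @ Q)}])"
  shows "CCC_provable (P @ [Disj F G] @ Q, [{..<length (P @ [Disj F G] @ Q)}])"
  using disj_introduction[OF assms] merge_pos_lessThan[of "length P" "length (P @ [F] @ Q)"]
  by (simp add: renumber_def)

text \<open>Both premises are moved to the common pool with \<open>F\<close> and \<open>G\<close>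
  adjacent. The ogroup from the first omits only \<open>G\<close>, the one from the second only
  \<open>F\<close>, so side by side they meet the side condition and merge into the full
  group.\<close>

lemma conj_disjunction_provable:
  assumes F: "CCC_provable (P @ [F] @ Q, [{..<length (P @ [F] @ Q)}])"
    and G: "CCC_provable (P @ [G] @ Q, [{..<length (P @ [G] @ Q)}])"
  shows "CCC_provable (P @ [Conj F G] @ Q, [{..<length (P @ [Conj F G] @ Q)}])"
proof -
  let ?R = "P @ [F, G] @ Q" and ?i = "length P"
  let ?all = "{..<length ?R}"
  have "CCC_provable (?R, renumber (skip_pos (Suc ?i)) [{..<length (P @ [F] @ Q)}])"
    by (rule CCC_renumber[OF F])
      (auto simp: skip_pos_def nth_append nth_Cons Suc_diff_le split: nat.splits)
  \<comment> \<open>The renumbered group already is this set; going through weakening leaves only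
    one inclusion to check.\<close>
  then have F': "CCC_provable (?R, [?all - {Suc ?i}])"
    unfolding renumber_def list.map
    by (rule weakening_group) (auto simp: skip_pos_def split: if_splits)
  have "CCC_provable (?R, renumber (skip_pos ?i) [{..<length (P @ [G] @ Q)}])"
    by (rule CCC_renumber[OF G])
      (auto simp: skip_pos_def nth_append nth_Cons Suc_diff_le split: nat.splits)
  then have G': "CCC_provable (?R, [?all - {?i}])"
    unfolding renumber_def list.map
    by (rule weakening_group) (auto simp: skip_pos_def split: if_splits)
  have "conj_ready ?i [?all - {Suc ?i}, ?all - {?i}]"
    by (simp add: conj_ready_def All_less_Suc)
  from conj_introduction[OF _ this] CCC_append_structures[OF F' G']
  have "CCC_provable (P @ [Conj F G] @ Q, renumber (merge_pos ?i)
      (merge_groups ?i [?all - {Suc ?i}, ?all - {?i}]))"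
    by simp
  moreover have "merge_groups ?i [?all - {Suc ?i}, ?all - {?i}] = [?all]"
    by auto
  moreover have "merge_pos ?i ` ?all = {..<length (P @ [Conj F G] @ Q)}"
    using merge_pos_lessThan[of ?i "length (P @ [F] @ Q)"] by simp
  ultimately show ?thesis by (simp only: renumber_def list.map)
qed

text \<open>Replacing a conjunction by either conjunct, or a disjunction by both disjuncts,
  preserves validity. The total size drops each time, although a disjunction lengthens the
  pool.\<close>

lemma valid_disjunction_provable:
  assumes "\<And>M. \<exists>F\<in>set P. formula_true M F"
  shows "CCC_provable (P, [{..<length P}])"
  using assms
proof (induction "sum_list (map size P)" arbitrary: P rule: less_induct)
  case less
  show ?case
  proof (cases "\<forall>F\<in>set P. \<exists>p. F = Atom p \<or> F = NegAtom p")
    case True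
    then show ?thesis using less.prems literal_disjunction_provable by blast
  next
    case False
    then obtain H where H: "H \<in> set P" "\<And>p. H \<noteq> Atom p \<and> H \<noteq> NegAtom p" by blast
    then obtain L R where P: "P = L @ [H] @ R" by (metis append_Cons append_Nil split_list)
    show ?thesis
    proof (cases H)
      case (Conj F G)
      have "CCC_provable (L @ [F] @ R, [{..<length (L @ [F] @ R)}])"
        by (rule less.hyps) (use less.prems in \<open>fastforce simp: P Conj\<close>)+
      moreover have "CCC_provable (L @ [G] @ R, [{..<length (L @ [G] @ R)}])"
        by (rule less.hyps) (use less.prems in \<open>fastforce simp: P Conj\<close>)+
      ultimately show ?thesis unfolding P Conj by (rule conj_disjunction_provable)
    next
      case (Disj F G)
      have "CCC_provable (L @ [F, G] @ R, [{..<length (L @ [F, G] @ R)}])"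
        by (rule less.hyps) (use less.prems in \<open>fastforce simp: P Disj\<close>)+
      then show ?thesis unfolding P Disj by (rule disj_disjunction_provable)
    qed (use H in auto)
  qed
qed

text \<open>The oformulas of \<open>A\<close> alone form a valid disjunction; \<open>xs\<close>
  lists their positions and thereby maps that smaller pool back into \<open>P\<close>.\<close>

lemma valid_group_provable:
  assumes A: "A \<subseteq> {..<length P}" and true: "\<And>M. group_true M P A"
  shows "CCC_provable (P, [A])"
proof -
  define xs where "xs = sorted_list_of_set A"
  have xs: "set xs = A"
    unfolding xs_def using A finite_subset by (metis finite_lessThan set_sorted_list_of_set)
  have "CCC_provable (map ((!) P) xs, [{..<length (map ((!) P) xs)}])"
    by (rule valid_disjunction_provable) (use true xs in \<open>auto simp: group_true_def\<close>)
  then have "CCC_provable (P, renumber ((!) xs) [{..<length (map ((!) P) xs)}])"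
    by (rule CCC_renumber) (use A xs in auto)
  moreover have "(!) xs ` {..<length xs} = A"
    using xs by (auto simp: set_conv_nth)
  ultimately show ?thesis by (simp add: renumber_def)
qed

text \<open>Every ogroup of a tautology is valid by itself, so the ogroups are proved separately and
  then joined over the common pool. For no ogroups, the pool is built from the empty axiom by
  weakening.\<close>

lemma CCC_complete:
  assumes "is_cirquent (P, S)" "tautology (P, S)"
  shows "CCC_provable (P, S)"
  using assms
proof (induction S)
  case Nil
  show ?case using weaken_front[OF empty_axiom, of P] by (simp add: renumber_def)
next
  case (Cons A S)
  have "CCC_provable (P, [A])"
    using Cons.prems
    by (intro valid_group_provable) (auto simp: is_cirquent_def tautology_def cirquent_true_def)
  moreover have "CCC_provable (P, S)"
    using Cons by (auto simp: is_cirquent_def tautology_def cirquent_true_def)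
  ultimately show ?case using CCC_append_structures by fastforce
qed

theorem theorem6p3:
  fixes C :: "'a cirquent"
  assumes "infinite (UNIV :: 'a set)"
    and "is_cirquent C"
  shows "CCC_provable C \<longleftrightarrow> tautology C"
  using assms(2) CCC_sound CCC_complete by (metis prod.collapse tautology_def)

end
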